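(* Let $G$ be a finitely generated group, let $\mathcal{H}$ be a separable Hilbert space, either real or complex, and let $\pi$ be a representation of $G$ on $\mathcal{H}$ that is orthogonal if $\mathcal{H}$ is real and unitary if $\mathcal{H}$ is complex. Then $\pi$ has almost invariant vectors if and only if the associated action $G \curvearrowright b\mathcal{H}$ has a nonzero fixed point, i.e., there is a nonzero $\varphi \in b\mathcal{H}$ with $g\varphi = \varphi$ for all $g \in G$.
   Context: $\mathbb{T} = \mathbb{R}/\mathbb{Z}$. The Bohr compactification of $\mathcal{H}$ is $b\mathcal{H} = \{\varphi \colon \mathcal{H} \to \mathbb{T} \mid \varphi(v+w) = \varphi(v)+\varphi(w) \text{ for all } v,w \in \mathcal{H}\}$, the set of all (not necessarily continuous) additive maps from $\mathcal{H}$ to $\mathbb{T}$, with pointwise addition and with the subspace topology induced from the product space $\mathbb{T}^{\mathcal{H}}$; it is a compact abelian group. The group $G$ acts on $b\mathcal{H}$ by $[g\varphi](v) = \varphi(\pi_g^{-1} v)$. The representation $\pi$ has almost invariant vectors if there exists a sequence of unit vectors $(u_n)_n$ in $\mathcal{H}$ such that $\lim_n \Vert \pi_g u_n - u_n\Vert = 0$ for each $g \in G$. *)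

theory Defs
  imports "HOL-Analysis.Analysis" "HOL-Algebra.Group_Action" "HOL-Algebra.Generated_Groups"
begin

subsection \<open>Complex inner product spaces\<close>

text \<open>
  A complex inner product space is presented on top of its underlying real inner product space,
  whose inner product is the real part of the complex one; so both induce the same norm, topology
  and notion of completeness. The complex inner product is linear in its first argument.
  Complex Hilbert spaces are the types of sort \<open>{complex_inner, complete_space}\<close>, and real ones
  those of sort \<open>{real_inner, complete_space}\<close>.
\<close>

class complex_inner = real_inner +
  fixes scaleC :: "complex \<Rightarrow> 'a \<Rightarrow> 'a"  (infixr \<open>*\<^sub>C\<close> 75)
    and cinner :: "'a \<Rightarrow> 'a \<Rightarrow> complex"
  assumes scaleC_add_right: "c *\<^sub>C (x + y) = c *\<^sub>C x + c *\<^sub>C y"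
    and scaleC_add_left: "(c + d) *\<^sub>C x = c *\<^sub>C x + d *\<^sub>C x"
    and scaleC_scaleC: "c *\<^sub>C (d *\<^sub>C x) = (c * d) *\<^sub>C x"
    and scaleC_of_real: "of_real r *\<^sub>C x = r *\<^sub>R x"
    and cinner_commute: "cinner x y = cnj (cinner y x)"
    and cinner_add_left: "cinner (x + y) z = cinner x z + cinner y z"
    and cinner_scaleC_left: "cinner (c *\<^sub>C x) y = c * cinner x y"
    and inner_eq_Re_cinner: "x \<bullet> y = Re (cinner x y)"

instantiation complex :: complex_inner
begin

definition scaleC_complex :: "complex \<Rightarrow> complex \<Rightarrow> complex"
  where "scaleC_complex c x = c * x"

definition cinner_complex :: "complex \<Rightarrow> complex \<Rightarrow> complex"
  where "cinner_complex x y = x * cnj y"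

instance
  by standard
    (simp_all add: scaleC_complex_def cinner_complex_def inner_complex_def algebra_simps scaleR_conv_of_real)

end


subsection \<open>Representations\<close>

definition finitely_generated :: "('g, 'm) monoid_scheme \<Rightarrow> bool"
  where "finitely_generated G \<longleftrightarrow> (\<exists>S. finite S \<and> S \<subseteq> carrier G \<and> generate G S = carrier G)"

text \<open>
  A group action on \<open>UNIV\<close> is a homomorphism into the group of all bijections of the type; this
  supplies the surjectivity of orthogonal and unitary operators, which is not part of
  \<open>orthogonal_transformation\<close>.
\<close>

locale orthogonal_representation = group_action G UNIV \<pi>
  for G :: "('g, 'm) monoid_scheme" (structure)
    and \<pi> :: "'g \<Rightarrow> 'h::real_inner \<Rightarrow> 'h" +
  assumes orthogonal: "g \<in> carrier G \<Longrightarrow> orthogonal_transformation (\<pi> g)"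

locale unitary_representation = group_action G UNIV \<pi>
  for G :: "('g, 'm) monoid_scheme" (structure)
    and \<pi> :: "'g \<Rightarrow> 'h::complex_inner \<Rightarrow> 'h" +
  assumes additive: "g \<in> carrier G \<Longrightarrow> \<pi> g (v + w) = \<pi> g v + \<pi> g w"
    and homogeneous: "g \<in> carrier G \<Longrightarrow> \<pi> g (c *\<^sub>C v) = c *\<^sub>C \<pi> g v"
    and cinner_preserving: "g \<in> carrier G \<Longrightarrow> cinner (\<pi> g v) (\<pi> g w) = cinner v w"

definition almost_invariant_vectors ::
    "('g, 'm) monoid_scheme \<Rightarrow> ('g \<Rightarrow> 'h::real_normed_vector \<Rightarrow> 'h) \<Rightarrow> bool"
  where "almost_invariant_vectors G \<pi> \<longleftrightarrow>
    (\<exists>u :: nat \<Rightarrow> 'h. (\<forall>n. norm (u n) = 1) \<and>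
      (\<forall>g\<in>carrier G. (\<lambda>n. norm (\<pi> g (u n) - u n)) \<longlonglongrightarrow> 0))"


subsection \<open>The Bohr compactification\<close>

quotient_type circle = real / "\<lambda>x y. x - y \<in> \<int>"
proof (rule equivpI)
  show "reflp (\<lambda>x y :: real. x - y \<in> \<int>)"
    by (simp add: reflp_def)
  show "symp (\<lambda>x y :: real. x - y \<in> \<int>)"
    by (metis (no_types, lifting) Ints_minus minus_diff_eq sympI)
  show "transp (\<lambda>x y :: real. x - y \<in> \<int>)"
    by (rule transpI) (metis Ints_add diff_add_cancel add_diff_eq)
qed

instantiation circle :: ab_group_add
begin

lift_definition zero_circle :: circle is 0 .

lift_definition plus_circle :: "circle \<Rightarrow> circle \<Rightarrow> circle" is "(+)"
  by (metis Ints_add add_diff_add)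

lift_definition uminus_circle :: "circle \<Rightarrow> circle" is uminus
  by (metis Ints_minus minus_diff_minus)

lift_definition minus_circle :: "circle \<Rightarrow> circle \<Rightarrow> circle" is "(-)"
  by (metis Ints_diff diff_diff_eq2 diff_diff_eq add_diff_eq diff_add_eq add.commute)

instance
  by standard (transfer; simp)+

end

text \<open>Only the underlying set matters for fixed points, so no topology is put on it.\<close>

definition bohr :: "('h::ab_group_add \<Rightarrow> circle) set"
  where "bohr = {\<phi>. \<forall>v w. \<phi> (v + w) = \<phi> v + \<phi> w}"

definition bohr_action :: "('g \<Rightarrow> 'h \<Rightarrow> 'h) \<Rightarrow> 'g \<Rightarrow> ('h \<Rightarrow> circle) \<Rightarrow> 'h \<Rightarrow> circle"
  where "bohr_action \<pi> g \<phi> = (\<lambda>v. \<phi> (inv_into UNIV (\<pi> g) v))"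

definition bohr_nonzero_fixed_point ::
    "('g, 'm) monoid_scheme \<Rightarrow> ('g \<Rightarrow> 'h::ab_group_add \<Rightarrow> 'h) \<Rightarrow> bool"
  where "bohr_nonzero_fixed_point G \<pi> \<longleftrightarrow>
    (\<exists>\<phi>\<in>bohr. \<phi> \<noteq> (\<lambda>_. 0) \<and> (\<forall>g\<in>carrier G. bohr_action \<pi> g \<phi> = \<phi>))"

end

theory Submission
  imports Defs
begin

text \<open>
  Let \<open>S\<close> be a finite generating set and let \<open>D\<close> be the linear span of all \<open>\<pi> s v - v\<close> with
  \<open>s \<in> S\<close>. A character fixed by \<open>G\<close> is one that vanishes on \<open>D\<close>. If \<open>D\<close> is a proper subspace,
  then a linear functional vanishing on \<open>D\<close>, reduced modulo \<open>\<int>\<close>, is a nonzero such character.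

  If unit vectors \<open>u n\<close> are almost invariant with rate \<open>\<delta> n\<close>, then every \<open>v \<in> D\<close> satisfies
  \<open>\<bar>u n \<bullet> v\<bar> \<le> C v * \<delta> n\<close>; so \<open>D\<close> cannot be the whole space, since by uniform boundedness
  \<open>u n /\<^sub>R \<delta> n\<close> would be bounded. If there are no almost invariant vectors, then
  \<open>v \<mapsto> \<Sum>s\<in>S. v - \<pi> s v\<close> is coercive, hence surjective (Lax-Milgram), and \<open>D\<close> is the whole space.
\<close>

section \<open>Uniform boundedness and Lax-Milgram in a real Hilbert space\<close>

text \<open>Baire category: the closed sets \<open>F k\<close> cover the space, so one of them
  contains a ball; comparing its centre with a point shifted in direction \<open>x\<close> bounds
  \<open>norm x\<close> uniformly.\<close>

lemma bounded_if_weakly_bounded: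
  fixes X :: "'a::{real_inner, complete_space} set"
  assumes "\<And>v. bounded ((\<lambda>x. x \<bullet> v) ` X)"
  shows "bounded X"
proof -
  define F where "F k = {v. \<forall>x\<in>X. \<bar>x \<bullet> v\<bar> \<le> real k}" for k
  have closed_F: "closed (F k)" for k
  proof -
    have "F k = (\<Inter>x\<in>X. {v. \<bar>x \<bullet> v\<bar> \<le> real k})"
      by (auto simp: F_def)
    also have "closed \<dots>"
      by (intro closed_INT ballI closed_Collect_le continuous_intros)
    finally show ?thesis .
  qed
  have "\<exists>k. v \<in> F k" for v
  proof -
    obtain C where "\<forall>x\<in>X. \<bar>x \<bullet> v\<bar> \<le> C"
      using assms[of v] by (auto simp: bounded_iff)
    then have "v \<in> F (nat \<lceil>C\<rceil>)"
      by (force simp: F_def intro: order_trans[OF _ real_nat_ceiling_ge])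
    then show ?thesis ..
  qed
  then have "\<Union>(range F) = UNIV"
    by blast
  moreover have "interior (\<Union>(range F)) = {}" if "\<And>k. interior (F k) = {}"
    using Baire_category_alt[of "euclidean :: 'a topology" "range F"] closed_F that
    by (auto simp: completely_metrizable_space_euclidean)
  ultimately obtain k where "interior (F k) \<noteq> {}"
    by auto
  then obtain a e where e: "e > 0" "ball a e \<subseteq> F k"
    by (auto simp: mem_interior)
  have "norm x \<le> 4 * real k / e" if "x \<in> X" for x
  proof (cases "x = 0")
    case False
    \<comment> \<open>The shift has length \<open>e / 2\<close>, so \<open>a + w\<close> stays in
      the ball, and \<open>x \<bullet> w\<close> is a difference of two values of size at most
      \<open>k\<close>.\<close>
    define w where "w = (e / (2 * norm x)) *\<^sub>R x"
    have "a \<in> F k" "a + w \<in> F k"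
      using e False by (auto simp: w_def dist_norm intro!: subsetD[OF e(2)])
    then have "\<bar>x \<bullet> a\<bar> \<le> real k" "\<bar>x \<bullet> (a + w)\<bar> \<le> real k"
      using that by (auto simp: F_def)
    moreover have "x \<bullet> w = e * norm x / 2"
      using False by (simp add: w_def dot_square_norm power2_eq_square)
    ultimately have "e * norm x \<le> 4 * real k"
      by (simp add: inner_add_right)
    then show ?thesis
      using e by (simp add: field_simps)
  qed (use e in simp)
  then show ?thesis
    by (auto simp: bounded_iff)
qed

text \<open>For small \<open>t > 0\<close> coercivity makes the map sending \<open>v\<close> to
  \<open>v - t *\<^sub>R (A v - f)\<close> a contraction, and its fixed point solves
  \<open>A v = f\<close>.\<close>

lemma coercive_imp_surj:
  fixes A :: "'a::{real_inner, complete_space} \<Rightarrow> 'a"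
  assumes "bounded_linear A" and "c > 0" and coercive: "\<And>v. c * (norm v)\<^sup>2 \<le> A v \<bullet> v"
  shows "surj A"
proof -
  interpret A: bounded_linear A by fact
  obtain M0 where M0: "\<And>v. norm (A v) \<le> norm v * M0"
    using A.bounded by blast
  \<comment> \<open>The maximum ensures \<open>M > 0\<close> for the divisions and
    \<open>c \<le> M\<close>, hence \<open>q \<ge> 0\<close>.\<close>
  define M where "M = max M0 c"
  have M: "M > 0" "c \<le> M" "norm (A v) \<le> M * norm v" for v
    using \<open>c > 0\<close> M0[of v] mult_right_mono[of M0 M "norm v"] by (auto simp: M_def mult.commute)
  \<comment> \<open>This \<open>t\<close> minimizes
    \<open>1 - 2 * t * c + t\<^sup>2 * M\<^sup>2\<close>, and \<open>q\<close> is the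
    minimum.\<close>
  define t where "t = c / M\<^sup>2"
  define q where "q = 1 - c\<^sup>2 / M\<^sup>2"
  have q: "0 \<le> q" "q < 1"
    using M(1,2) \<open>c > 0\<close> power_mono[of c M 2] by (auto simp: q_def divide_simps)
  have contraction: "norm (v - t *\<^sub>R A v) \<le> sqrt q * norm v" for v
  proof -
    have "(norm (v - t *\<^sub>R A v))\<^sup>2 = (norm v)\<^sup>2 - 2 * t * (A v \<bullet> v) + t\<^sup>2 * (norm (A v))\<^sup>2"
      unfolding power2_norm_eq_inner
      by (simp add: inner_diff_left inner_diff_right inner_commute power2_eq_square algebra_simps)
    also have "\<dots> \<le> (norm v)\<^sup>2 - 2 * t * (c * (norm v)\<^sup>2) + t\<^sup>2 * (M * norm v)\<^sup>2"
      using coercive[of v] M \<open>c > 0\<close>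
      by (intro add_mono diff_mono mult_left_mono power_mono) (auto simp: t_def)
    also have "\<dots> = q * (norm v)\<^sup>2"
      using M(1) by (simp add: q_def t_def field_simps power2_eq_square)
    also have "\<dots> = (sqrt q * norm v)\<^sup>2"
      using q by (simp add: power_mult_distrib)
    finally show ?thesis
      by (rule power2_le_imp_le) (use q in simp)
  qed
  have "\<exists>v. A v = f" for f
  proof -
    have "\<exists>!v. v - t *\<^sub>R (A v - f) = v"
    proof (rule banach_fix_type[of "sqrt q"])
      show "\<forall>v w. dist (v - t *\<^sub>R (A v - f)) (w - t *\<^sub>R (A w - f)) \<le> sqrt q * dist v w"
      proof (intro allI)
        fix v w
        show "dist (v - t *\<^sub>R (A v - f)) (w - t *\<^sub>R (A w - f)) \<le> sqrt q * dist v w"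
        proof -
          have "v - t *\<^sub>R (A v - f) - (w - t *\<^sub>R (A w - f)) = (v - w) - t *\<^sub>R A (v - w)"
            by (simp add: A.diff scaleR_diff_right)
          then show ?thesis
            using contraction[of "v - w"] by (simp only: dist_norm)
        qed
      qed
    qed (use q in auto)
    moreover have "t \<noteq> 0"
      using M(1) \<open>c > 0\<close> by (simp add: t_def)
    ultimately show ?thesis
      by auto
  qed
  then show ?thesis
    by (metis surjI)
qed

section \<open>Characters vanishing on a proper subspace\<close>

text \<open>A Hamel basis argument, so \<open>f\<close> may be discontinuous. This matters because
  the span of \<open>D\<close> can be proper and yet dense.\<close>

lemma proper_subspace_functional:
  fixes D :: "'a::real_vector set"
  assumes "span D \<noteq> UNIV"
  obtains f :: "'a \<Rightarrow> real" and v where "linear f" "\<forall>x\<in>D. f x = 0" "f v = 1"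
proof -
  obtain v where v: "v \<notin> span D"
    using assms by blast
  obtain B where B: "B \<subseteq> D" "independent B" "D \<subseteq> span B"
    using maximal_independent_subset by blast
  have "v \<notin> span B"
    using v B(1) span_mono by blast
  then have "independent (insert v B)" "v \<notin> B"
    using B(2) by (auto simp: independent_insert span_base)
  then obtain f :: "'a \<Rightarrow> real" where f: "linear f" "\<forall>x\<in>insert v B. f x = (if x = v then 1 else 0)"
    using linear_independent_extend[of "insert v B" "\<lambda>x. if x = v then 1 else 0"] by metis
  have "f x = 0" if "x \<in> B" for x
    using f(2) \<open>v \<notin> B\<close> that by auto
  then have "\<forall>x\<in>D. f x = 0"
    using linear_eq_0_on_span[OF f(1), of B] B(3) by blast
  moreover have "f v = 1"
    using f(2) by simp
  ultimately show thesis
    using f(1) that by metis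
qed

lemma bohr_nonzero_of_proper_subspace:
  fixes D :: "'h::real_vector set"
  assumes "span D \<noteq> UNIV"
  obtains \<phi> where "\<phi> \<in> bohr" "\<phi> \<noteq> (\<lambda>_. 0)" "\<forall>x\<in>D. \<phi> x = 0"
proof -
  obtain f :: "'h \<Rightarrow> real" and v where f: "linear f" "\<forall>x\<in>D. f x = 0" "f v = 1"
    using proper_subspace_functional[OF assms] by metis
  define \<phi> where "\<phi> x = abs_circle (f x)" for x
  have "\<phi> \<in> bohr"
    by (simp add: bohr_def \<phi>_def linear_add[OF f(1)] plus_circle.abs_eq)
  \<comment> \<open>The value \<open>f v = 1\<close> dies modulo the integers, so nonvanishing is
    tested at half of \<open>v\<close>.\<close>
  moreover have "1 / 2 \<notin> (\<int> :: real set)"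
    by (simp add: fraction_not_in_Ints[of 2 1, simplified])
  then have "\<phi> ((1/2) *\<^sub>R v) \<noteq> 0"
    by (simp add: \<phi>_def linear_scale[OF f(1)] f(3) zero_circle_def circle.abs_eq_iff)
  then have "\<phi> \<noteq> (\<lambda>_. 0)"
    by metis
  moreover have "\<forall>x\<in>D. \<phi> x = 0"
    using f(2) by (simp add: \<phi>_def zero_circle_def)
  ultimately show thesis
    using that by blast
qed

section \<open>Fixed characters and displacements under an orthogonal representation\<close>

context orthogonal_representation
begin

sublocale group G
  using group_hom group_hom.axioms(1) by blast

lemma linear_rep: "g \<in> carrier G \<Longrightarrow> linear (\<pi> g)"
  using orthogonal orthogonal_transformation_linear by blast

lemma norm_rep: "g \<in> carrier G \<Longrightarrow> norm (\<pi> g v) = norm v"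
  using orthogonal orthogonal_transformation_norm by blast

lemma rep_inv_left: "g \<in> carrier G \<Longrightarrow> \<pi> (inv g) (\<pi> g v) = v"
  by (rule orbit_sym_aux) auto

lemma rep_inv_right: "g \<in> carrier G \<Longrightarrow> \<pi> g (\<pi> (inv g) v) = v"
  using rep_inv_left[of "inv g" v] by simp

lemma inner_rep_left:
  assumes "g \<in> carrier G"
  shows "\<pi> g v \<bullet> w = v \<bullet> \<pi> (inv g) w"
  using orthogonal[OF assms] rep_inv_right[OF assms]
  by (metis orthogonal_transformation_def)

text \<open>Replacing \<open>v\<close> by \<open>\<pi> g v\<close> removes the inverse from the
  action; as \<open>\<pi> g\<close> is surjective, nothing is lost.\<close>

lemma bohr_action_fixed_iff:
  assumes "g \<in> carrier G" and "\<phi> \<in> bohr"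
  shows "bohr_action \<pi> g \<phi> = \<phi> \<longleftrightarrow> (\<forall>v. \<phi> (\<pi> g v - v) = 0)"
proof -
  interpret \<phi>: additive \<phi>
    using assms(2) by unfold_locales (simp add: bohr_def)
  have "inv_into UNIV (\<pi> g) (\<pi> g v) = v" for v
    using inj_prop[OF assms(1)] by simp
  moreover have "surj (\<pi> g)"
    using surj_prop[OF assms(1)] .
  ultimately show ?thesis
    unfolding bohr_action_def fun_eq_iff \<phi>.diff right_minus_eq by (metis surjD)
qed

lemma norm_rep_mult_diff_le:
  assumes "g \<in> carrier G" "h \<in> carrier G"
  shows "norm (\<pi> (g \<otimes> h) v - v) \<le> norm (\<pi> g v - v) + norm (\<pi> h v - v)"
proof -
  have "norm (\<pi> (g \<otimes> h) v - v) = norm ((\<pi> g v - v) + \<pi> g (\<pi> h v - v))"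
    using assms composition_rule[of v g h] by (simp add: linear_diff[OF linear_rep])
  also have "\<dots> \<le> norm (\<pi> g v - v) + norm (\<pi> h v - v)"
    using norm_triangle_ineq norm_rep[OF assms(1)] by metis
  finally show ?thesis .
qed

lemma norm_rep_inv_diff:
  assumes "g \<in> carrier G"
  shows "norm (\<pi> (inv g) v - v) = norm (\<pi> g v - v)"
  using assms norm_rep[of g "\<pi> (inv g) v - v"]
  by (simp add: linear_diff[OF linear_rep] rep_inv_right norm_minus_commute)

lemma rep_one: "\<pi> \<one> v = v"
  using id_eq_one by (metis UNIV_I restrict_apply')

text \<open>The displacement of a vector is subadditive in the group element and unchanged under
  inversion, so convergence to 0 passes to words in \<open>S\<close>.\<close>

lemma almost_invariant_on_generate:
  assumes "S \<subseteq> carrier G" and "g \<in> generate G S"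
    and S: "\<And>s. s \<in> S \<Longrightarrow> (\<lambda>n. norm (\<pi> s (u n) - u n)) \<longlonglongrightarrow> 0"
  shows "(\<lambda>n. norm (\<pi> g (u n) - u n)) \<longlonglongrightarrow> 0"
  using assms(2)
proof induction
  case (eng g h)
  then have carrier: "g \<in> carrier G" "h \<in> carrier G"
    using generate_incl[OF assms(1)] by auto
  show ?case
  proof (rule Lim_null_comparison[OF always_eventually])
    show "\<forall>n. norm (norm (\<pi> (g \<otimes> h) (u n) - u n)) \<le> norm (\<pi> g (u n) - u n) + norm (\<pi> h (u n) - u n)"
      using norm_rep_mult_diff_le[OF carrier] by simp
    show "(\<lambda>n. norm (\<pi> g (u n) - u n) + norm (\<pi> h (u n) - u n)) \<longlonglongrightarrow> 0"
      using tendsto_add[OF eng.IH] by simp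
  qed
qed (use assms(1) S in \<open>auto simp: norm_rep_inv_diff rep_one subset_iff\<close>)

text \<open>The elements that leave \<open>\<phi>\<close> invariant form a subgroup.\<close>

lemma bohr_vanish_on_generate:
  assumes "S \<subseteq> carrier G" and "\<phi> \<in> bohr" and "g \<in> generate G S"
    and S: "\<And>s v. s \<in> S \<Longrightarrow> \<phi> (\<pi> s v - v) = 0"
  shows "\<phi> (\<pi> g v - v) = 0"
proof -
  interpret \<phi>: additive \<phi>
    using assms(2) by unfold_locales (simp add: bohr_def)
  have "\<forall>v. \<phi> (\<pi> g v) = \<phi> v"
    using assms(3)
  proof induction
    case (inv h)
    then show ?case
      using S assms(1) rep_inv_right by (metis \<phi>.diff right_minus_eq subsetD)
  next
    case (eng g h)
    then have carrier: "g \<in> carrier G" "h \<in> carrier G"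
      using generate_incl[OF assms(1)] by auto
    then show ?case
      using eng.IH composition_rule by simp
  qed (use S in \<open>auto simp: rep_one \<phi>.diff\<close>)
  then show ?thesis
    by (simp add: \<phi>.diff)
qed

text \<open>If no \<open>c\<close> worked, unit vectors with arbitrarily small total displacement
  over \<open>S\<close> would be almost invariant under all of \<open>G\<close>.\<close>

lemma spectral_gap:
  assumes "finite S" "S \<subseteq> carrier G" "generate G S = carrier G"
    and "\<not> almost_invariant_vectors G \<pi>"
  obtains c where "c > 0" "\<forall>v. c * (norm v)\<^sup>2 \<le> (\<Sum>s\<in>S. (norm (\<pi> s v - v))\<^sup>2)"
proof -
  define E where "E v = (\<Sum>s\<in>S. (norm (\<pi> s v - v))\<^sup>2)" for v
  have "\<exists>c>0. \<forall>v. norm v = 1 \<longrightarrow> c \<le> E v"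
  proof (rule ccontr)
    assume "\<not> ?thesis"
    then have "\<exists>v. norm v = 1 \<and> E v < inverse (real (Suc n))" for n
      by (metis inverse_positive_iff_positive not_le of_nat_0_less_iff zero_less_Suc)
    then obtain u where u: "\<And>n. norm (u n) = 1" "\<And>n. E (u n) < inverse (real (Suc n))"
      by metis
    have "(\<lambda>n. norm (\<pi> s (u n) - u n)) \<longlonglongrightarrow> 0" if "s \<in> S" for s
    proof -
      have "(norm (\<pi> s (u n) - u n))\<^sup>2 \<le> E (u n)" for n
        unfolding E_def by (rule member_le_sum[OF that]) (use assms(1) in auto)
      then have "(\<lambda>n. (norm (\<pi> s (u n) - u n))\<^sup>2) \<longlonglongrightarrow> 0"
        using order_trans[OF _ less_imp_le[OF u(2)]]
        by (intro Lim_null_comparison[OF always_eventually LIMSEQ_inverse_real_of_nat]) simp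
      then have "(\<lambda>n. sqrt ((norm (\<pi> s (u n) - u n))\<^sup>2)) \<longlonglongrightarrow> sqrt 0"
        by (rule tendsto_real_sqrt)
      then show ?thesis
        by simp
    qed
    then have "almost_invariant_vectors G \<pi>"
      unfolding almost_invariant_vectors_def
      using u(1) almost_invariant_on_generate[OF assms(2)] assms(3) by blast
    with assms(4) show False ..
  qed
  then obtain c where c: "c > 0" "\<And>v. norm v = 1 \<Longrightarrow> c \<le> E v"
    by blast
  have "c * (norm v)\<^sup>2 \<le> E v" for v
  proof (cases "v = 0")
    case False
    \<comment> \<open>\<open>E\<close> is homogeneous of degree 2, which reduces the bound to unit
      vectors.\<close>
    define w where "w = v /\<^sub>R norm v"
    have "v = norm v *\<^sub>R w"
      using False by (simp add: w_def)
    then have "\<pi> s v - v = norm v *\<^sub>R (\<pi> s w - w)" if "s \<in> S" for s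
      using that assms(2) linear_scale[OF linear_rep] by (metis scaleR_right_diff_distrib subsetD)
    then have "E v = (norm v)\<^sup>2 * E w"
      by (simp add: E_def sum_distrib_left power_mult_distrib)
    moreover have "c \<le> E w"
      using False by (intro c(2)) (simp add: w_def)
    ultimately show ?thesis
      by (simp add: mult.commute mult_right_mono)
  qed (simp add: E_def sum_nonneg)
  with c(1) that show thesis
    unfolding E_def by blast
qed

end

section \<open>The two implications for real Hilbert spaces\<close>

lemma proper_span_if_almost_invariant:
  fixes \<pi> :: "'g \<Rightarrow> 'h::{real_inner, complete_space} \<Rightarrow> 'h"
  assumes "orthogonal_representation G \<pi>" "finite S" "S \<subseteq> carrier G"
    and "almost_invariant_vectors G \<pi>"
  shows "span (\<Union>s\<in>S. range (\<lambda>v. \<pi> s v - v)) \<noteq> UNIV" (is "span ?D \<noteq> UNIV")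
proof
  interpret orthogonal_representation G \<pi> by fact
  assume span: "span ?D = UNIV"
  obtain u where u: "\<And>n. norm (u n) = 1"
      "\<And>g. g \<in> carrier G \<Longrightarrow> (\<lambda>n. norm (\<pi> g (u n) - u n)) \<longlonglongrightarrow> 0"
    using assms(4) unfolding almost_invariant_vectors_def by blast
  \<comment> \<open>The second summand keeps \<open>\<delta> n\<close> positive even if \<open>u n\<close> is invariant.\<close>
  define \<delta> where "\<delta> n = (\<Sum>s\<in>S. norm (\<pi> s (u n) - u n)) + inverse (real (Suc n))" for n
  have \<delta>_pos: "\<delta> n > 0" for n
    unfolding \<delta>_def by (intro add_nonneg_pos sum_nonneg) auto
  have "\<delta> \<longlonglongrightarrow> (\<Sum>s\<in>S. 0) + 0"
    unfolding \<delta>_def using assms(3)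
    by (intro tendsto_add tendsto_sum u(2) LIMSEQ_inverse_real_of_nat) auto
  then have \<delta>_lim: "\<delta> \<longlonglongrightarrow> 0"
    by simp
  \<comment> \<open>Since these vectors form a subspace, the decay rate \<open>\<delta>\<close> need
    only be checked on the spanning vectors \<open>\<pi> s v - v\<close>.\<close>
  have "subspace {v. \<exists>C. \<forall>n. \<bar>u n \<bullet> v\<bar> \<le> C * \<delta> n}" (is "subspace ?V")
  proof (rule subspaceI)
    show "0 \<in> ?V"
      by (auto intro!: exI[of _ 0])
  next
    fix v w assume "v \<in> ?V" "w \<in> ?V"
    then obtain C C' where "\<And>n. \<bar>u n \<bullet> v\<bar> \<le> C * \<delta> n" "\<And>n. \<bar>u n \<bullet> w\<bar> \<le> C' * \<delta> n"
      by blast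
    then have "\<bar>u n \<bullet> (v + w)\<bar> \<le> (C + C') * \<delta> n" for n
      unfolding inner_add_right distrib_right
      by (intro order_trans[OF abs_triangle_ineq] add_mono)
    then show "v + w \<in> ?V"
      by blast
  next
    fix r v assume "v \<in> ?V"
    then obtain C where "\<And>n. \<bar>u n \<bullet> v\<bar> \<le> C * \<delta> n"
      by blast
    then have "\<bar>u n \<bullet> (r *\<^sub>R v)\<bar> \<le> (\<bar>r\<bar> * C) * \<delta> n" for n
      by (simp add: abs_mult mult.assoc mult_left_mono)
    then show "r *\<^sub>R v \<in> ?V"
      by blast
  qed
  moreover have "?D \<subseteq> ?V"
  proof clarify
    fix s v assume "s \<in> S"
    then have s: "s \<in> carrier G"
      using assms(3) by blast
    have "\<bar>u n \<bullet> (\<pi> s v - v)\<bar> \<le> norm v * \<delta> n" for n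
    proof -
      \<comment> \<open>Passing to the adjoint \<open>\<pi> (inv s)\<close> moves the displacement
        onto \<open>u n\<close>, where it is small.\<close>
      have "u n \<bullet> (\<pi> s v - v) = (\<pi> (inv\<^bsub>G\<^esub> s) (u n) - u n) \<bullet> v"
        using inner_rep_left[OF s, of v "u n"]
        by (simp add: inner_diff_left inner_diff_right inner_commute)
      also have "\<bar>\<dots>\<bar> \<le> norm (\<pi> s (u n) - u n) * norm v"
        using Cauchy_Schwarz_ineq2 norm_rep_inv_diff[OF s] by metis
      also have "norm (\<pi> s (u n) - u n) \<le> \<delta> n"
        using member_le_sum[OF \<open>s \<in> S\<close> _ assms(2), of "\<lambda>s. norm (\<pi> s (u n) - u n)"]
        by (simp add: \<delta>_def add_increasing2)
      finally show ?thesis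
        by (simp add: mult.commute mult_right_mono)
    qed
    then show "\<exists>C. \<forall>n. \<bar>u n \<bullet> (\<pi> s v - v)\<bar> \<le> C * \<delta> n"
      by blast
  qed
  ultimately have weak: "\<exists>C. \<forall>n. \<bar>u n \<bullet> v\<bar> \<le> C * \<delta> n" for v
    using span_minimal[of ?D ?V] span by blast
  have "bounded (range (\<lambda>n. u n /\<^sub>R \<delta> n))"
  proof (rule bounded_if_weakly_bounded)
    fix v
    obtain C where "\<And>n. \<bar>u n \<bullet> v\<bar> \<le> C * \<delta> n"
      using weak by blast
    then have "\<bar>(u n /\<^sub>R \<delta> n) \<bullet> v\<bar> \<le> C" for n
      using \<delta>_pos[of n] by (simp add: abs_mult field_simps)
    then show "bounded ((\<lambda>x. x \<bullet> v) ` range (\<lambda>n. u n /\<^sub>R \<delta> n))"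
      by (auto simp: bounded_iff)
  qed
  then obtain B where "B > 0" "\<forall>n. norm (u n /\<^sub>R \<delta> n) \<le> B"
    unfolding bounded_pos by blast
  then have B: "B > 0" "inverse (\<delta> n) \<le> B" for n
    using \<delta>_pos[of n] u(1)[of n] by (auto dest!: spec[of _ n])
  \<comment> \<open>The rescaled vectors have norm \<open>inverse (\<delta> n)\<close>, so their
    boundedness keeps \<open>\<delta>\<close> away from 0.\<close>
  have "inverse B \<le> \<delta> n" for n
    using B(2)[of n] \<delta>_pos[of n] B(1) by (simp add: field_simps)
  then have "inverse B \<le> 0"
    using \<delta>_lim by (intro LIMSEQ_le_const) auto
  with B(1) show False
    by simp
qed

text \<open>As \<open>\<phi>\<close> may be discontinuous, vanishing on a dense subspace would not
  make it zero; the surjectivity from Lax-Milgram provides every vector.\<close>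

lemma almost_invariant_if_fixed_point:
  fixes \<pi> :: "'g \<Rightarrow> 'h::{real_inner, complete_space} \<Rightarrow> 'h"
  assumes "orthogonal_representation G \<pi>"
    and S: "finite S" "S \<subseteq> carrier G" "generate G S = carrier G"
    and "bohr_nonzero_fixed_point G \<pi>"
  shows "almost_invariant_vectors G \<pi>"
proof (rule ccontr)
  interpret orthogonal_representation G \<pi> by fact
  assume "\<not> almost_invariant_vectors G \<pi>"
  then obtain c where c: "c > 0" "\<forall>v. c * (norm v)\<^sup>2 \<le> (\<Sum>s\<in>S. (norm (\<pi> s v - v))\<^sup>2)"
    using spectral_gap[OF S] by metis
  define A where "A v = (\<Sum>s\<in>S. \<pi> s v - v)" for v
  have "bounded_linear (\<pi> s)" if "s \<in> S" for s
    using that S(2) linear_rep[of s] norm_rep[of s]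
    by (intro bounded_linear_intro[of _ 1]) (auto simp: linear_add linear_scale)
  then have "bounded_linear (\<lambda>v. - A v)"
    unfolding A_def
    by (intro bounded_linear_minus bounded_linear_sum bounded_linear_sub bounded_linear_ident)
  moreover have "c / 2 * (norm v)\<^sup>2 \<le> - A v \<bullet> v" for v
  proof -
    \<comment> \<open>As \<open>\<pi> s\<close> is isometric, \<open>v - \<pi> s v\<close> has inner product \<open>(norm (\<pi> s v - v))\<^sup>2 / 2\<close> with \<open>v\<close>.\<close>
    have "(norm (\<pi> s v - v))\<^sup>2 = - 2 * ((\<pi> s v - v) \<bullet> v)" if "s \<in> S" for s
    proof -
      have "\<pi> s v \<bullet> \<pi> s v = v \<bullet> v"
        using that S(2) norm_rep[of s v] by (metis norm_eq subsetD)
      then show ?thesis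
        by (simp add: power2_norm_eq_inner inner_diff_left inner_diff_right inner_commute)
    qed
    then have "(\<Sum>s\<in>S. (norm (\<pi> s v - v))\<^sup>2) = - 2 * (A v \<bullet> v)"
      by (simp add: A_def inner_sum_left sum_distrib_left)
    then show ?thesis
      using spec[OF c(2), of v] by simp
  qed
  ultimately have surj: "surj (\<lambda>v. - A v)"
    using c(1) by (intro coercive_imp_surj[of _ "c / 2"]) auto
  obtain \<phi> where \<phi>: "\<phi> \<in> bohr" "\<phi> \<noteq> (\<lambda>_. 0)" "\<And>g. g \<in> carrier G \<Longrightarrow> bohr_action \<pi> g \<phi> = \<phi>"
    using assms(5) unfolding bohr_nonzero_fixed_point_def by blast
  interpret \<phi>: additive \<phi>
    using \<phi>(1) by unfold_locales (simp add: bohr_def)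
  have "\<phi> (\<pi> s v - v) = 0" if "s \<in> S" for s v
    using that S(2) \<phi>(3) bohr_action_fixed_iff[OF _ \<phi>(1)] by blast
  \<comment> \<open>Each value of \<open>A\<close> is a finite sum of displacements, all killed by
    \<open>\<phi>\<close>.\<close>
  then have "\<phi> (- A v) = 0" for v
    by (simp add: A_def \<phi>.minus \<phi>.sum)
  then have "\<phi> w = 0" for w
    using surj by (metis surjD)
  with \<phi>(2) show False
    by blast
qed

lemma fixed_point_if_almost_invariant:
  fixes \<pi> :: "'g \<Rightarrow> 'h::{real_inner, complete_space} \<Rightarrow> 'h"
  assumes "orthogonal_representation G \<pi>"
    and S: "finite S" "S \<subseteq> carrier G" "generate G S = carrier G"
    and "almost_invariant_vectors G \<pi>"
  shows "bohr_nonzero_fixed_point G \<pi>"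
proof -
  interpret orthogonal_representation G \<pi> by fact
  obtain \<phi> where \<phi>: "\<phi> \<in> bohr" "\<phi> \<noteq> (\<lambda>_. 0)"
      "\<forall>x\<in>\<Union>s\<in>S. range (\<lambda>v. \<pi> s v - v). \<phi> x = 0"
    by (rule bohr_nonzero_of_proper_subspace[OF
          proper_span_if_almost_invariant[OF assms(1) S(1,2) assms(5)]])
  have "\<phi> (\<pi> g v - v) = 0" if "g \<in> carrier G" for g v
  proof (rule bohr_vanish_on_generate[OF S(2) \<phi>(1)])
    show "g \<in> generate G S"
      using that S(3) by simp
  qed (use \<phi>(3) in blast)
  then have "bohr_action \<pi> g \<phi> = \<phi>" if "g \<in> carrier G" for g
    using that bohr_action_fixed_iff[OF that \<phi>(1)] by simp
  with \<phi> show ?thesis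
    unfolding bohr_nonzero_fixed_point_def by blast
qed

lemma almost_invariant_iff_fixed_point:
  fixes \<pi> :: "'g \<Rightarrow> 'h::{real_inner, complete_space} \<Rightarrow> 'h"
  assumes "finitely_generated G" and "orthogonal_representation G \<pi>"
  shows "almost_invariant_vectors G \<pi> \<longleftrightarrow> bohr_nonzero_fixed_point G \<pi>"
proof -
  obtain S where "finite S" "S \<subseteq> carrier G" "generate G S = carrier G"
    using assms(1) unfolding finitely_generated_def by blast
  with assms(2) show ?thesis
    using almost_invariant_if_fixed_point fixed_point_if_almost_invariant by blast
qed

section \<open>Reduction of the complex case to the real one\<close>

text \<open>The real inner product is the real part of the preserved complex one. Almost invariance
  and fixed characters involve only the norm and the additive structure, so the real result
  transfers.\<close>

lemma unitary_imp_orthogonal_representation: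
  assumes "unitary_representation G \<rho>"
  shows "orthogonal_representation G \<rho>"
proof -
  interpret unitary_representation G \<rho> by fact
  have "linear (\<rho> g)" if "g \<in> carrier G" for g
  proof (rule linearI)
    show "\<rho> g (v + w) = \<rho> g v + \<rho> g w" for v w
      using that by (rule additive)
    show "\<rho> g (r *\<^sub>R v) = r *\<^sub>R \<rho> g v" for r v
      using homogeneous[OF that, of "of_real r" v] by (simp only: scaleC_of_real)
  qed
  then show ?thesis
    by unfold_locales
      (simp add: orthogonal_transformation_def inner_eq_Re_cinner cinner_preserving)
qed

theorem theorem1:
  fixes G :: "('g, 'm) monoid_scheme"
    and \<pi> :: "'g \<Rightarrow> 'h::{real_inner, complete_space} \<Rightarrow> 'h"
    and \<rho> :: "'g \<Rightarrow> 'k::{complex_inner, complete_space} \<Rightarrow> 'k"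
  assumes "group G" and "finitely_generated G"
  shows "(separable_space (euclidean :: 'h topology) \<and> orthogonal_representation G \<pi> \<longrightarrow>
            (almost_invariant_vectors G \<pi> \<longleftrightarrow> bohr_nonzero_fixed_point G \<pi>)) \<and>
         (separable_space (euclidean :: 'k topology) \<and> unitary_representation G \<rho> \<longrightarrow>
            (almost_invariant_vectors G \<rho> \<longleftrightarrow> bohr_nonzero_fixed_point G \<rho>))"
  using almost_invariant_iff_fixed_point[OF assms(2), of \<pi>]
    almost_invariant_iff_fixed_point[OF assms(2), of \<rho>]
    unitary_imp_orthogonal_representation[of G \<rho>]
  by blast

end
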